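(* Let $\mathcal{I}$ be a proper ideal on $\mathbf{N}$ and let $\mu=(\mu_n)_{n\in\mathbf{N}}$ be a smooth sequence of lower semicontinuous submeasures. Then the ideal $\mathcal{J}(\mathcal{I},\mu)$ is Borel [respectively analytic, coanalytic] whenever $\mathcal{I}$ is Borel [respectively analytic, coanalytic].
   Context: $\mathbf{N}$ denotes the positive integers. An ideal on $\mathbf{N}$ is a family $\mathcal{I}\subseteq\mathcal{P}(\mathbf{N})$ closed under finite unions and subsets and containing all finite subsets of $\mathbf{N}$; it is proper if $\mathcal{I}\neq\mathcal{P}(\mathbf{N})$. Sets are identified with their characteristic functions, so $\mathcal{P}(\mathbf{N})$ carries the Cantor-space topology of $\{0,1\}^{\mathbf{N}}$; "Borel", "analytic", "coanalytic" for an ideal refer to it as a subset of this space. A submeasure is a map $\varphi:\mathcal{P}(\mathbf{N})\to[0,\infty]$ such that $\varphi(\emptyset)=0$, $\varphi(A)\le\varphi(B)$ if $A\subseteq B$, $\varphi(A\cup B)\le\varphi(A)+\varphi(B)$, and $\varphi(\{n\})<\infty$ for all $n\in\mathbf{N}$. It is lower semicontinuous if $\varphi(A)=\lim_{n\to\infty}\varphi(A\cap[1,n])$ for all $A\subseteq\mathbf{N}$. A sequence of submeasures $\mu=(\mu_n)$ is smooth if: (S1) for all $n$, $\mu_n$ is supported on a nonempty set $I_n\subseteq\mathbf{N}$ (i.e. $\mu_n(A)=\mu_n(A\cap I_n)$ for all $A$); (S2) $\lim_{n\to\infty}\mu_n(\{k\})=0$ for all $k\in\mathbf{N}$; (S3)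 $\limsup_{n\to\infty}\mu_n(\mathbf{N})>0$. $\mathcal{J}(\mathcal{I},\mu)$ is the (not necessarily proper) ideal $$\mathcal{J}(\mathcal{I},\mu)=\{A\subseteq\mathbf{N}:\mu_n(A)\to_{\mathcal{I}}0\}=\{A\subseteq\mathbf{N}:\{n\in\mathbf{N}:\mu_n(A)\ge\varepsilon\}\in\mathcal{I}\text{ for all }\varepsilon>0\}.$$ *)

theory Defs
  imports "HOL-Analysis.Analysis"
begin

(* N is the set of positive integers. A submeasure is only constrained on subsets of Npos,
   a sequence of submeasures only at indices in Npos. *)
abbreviation Npos :: "nat set" where
  "Npos \<equiv> {1..}"

definition ideal_on_N :: "nat set set \<Rightarrow> bool" where
  "ideal_on_N I \<longleftrightarrow>
     I \<subseteq> Pow Npos \<and>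
     (\<forall>A B. A \<in> I \<and> B \<in> I \<longrightarrow> A \<union> B \<in> I) \<and>
     (\<forall>A B. B \<in> I \<and> A \<subseteq> B \<longrightarrow> A \<in> I) \<and>
     (\<forall>F. finite F \<and> F \<subseteq> Npos \<longrightarrow> F \<in> I)"

definition proper_ideal_on_N :: "nat set set \<Rightarrow> bool" where
  "proper_ideal_on_N I \<longleftrightarrow> ideal_on_N I \<and> I \<noteq> Pow Npos"

definition submeasure :: "(nat set \<Rightarrow> ennreal) \<Rightarrow> bool" where
  "submeasure \<phi> \<longleftrightarrow>
     \<phi> {} = 0 \<and>
     (\<forall>A B. A \<subseteq> B \<and> B \<subseteq> Npos \<longrightarrow> \<phi> A \<le> \<phi> B) \<and>
     (\<forall>A B. A \<subseteq> Npos \<and> B \<subseteq> Npos \<longrightarrow> \<phi> (A \<union> B) \<le> \<phi> A + \<phi> B) \<and>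
     (\<forall>n\<in>Npos. \<phi> {n} < \<infinity>)"

definition lsc_submeasure :: "(nat set \<Rightarrow> ennreal) \<Rightarrow> bool" where
  "lsc_submeasure \<phi> \<longleftrightarrow>
     submeasure \<phi> \<and>
     (\<forall>A\<subseteq>Npos. (\<lambda>n. \<phi> (A \<inter> {1..n})) \<longlonglongrightarrow> \<phi> A)"

definition smooth_seq :: "(nat \<Rightarrow> nat set \<Rightarrow> ennreal) \<Rightarrow> bool" where
  "smooth_seq \<mu> \<longleftrightarrow>
     (\<forall>n\<in>Npos. submeasure (\<mu> n)) \<and>
     (\<forall>n\<in>Npos. \<exists>S\<subseteq>Npos. S \<noteq> {} \<and> (\<forall>A\<subseteq>Npos. \<mu> n A = \<mu> n (A \<inter> S))) \<and>
     (\<forall>k\<in>Npos. (\<lambda>n. \<mu> n {k}) \<longlonglongrightarrow> 0) \<and>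
     limsup (\<lambda>n. \<mu> n Npos) > 0"

definition ideal_J :: "nat set set \<Rightarrow> (nat \<Rightarrow> nat set \<Rightarrow> ennreal) \<Rightarrow> nat set set" where
  "ideal_J I \<mu> =
     {A. A \<subseteq> Npos \<and> (\<forall>\<epsilon>::real. \<epsilon> > 0 \<longrightarrow> {n\<in>Npos. \<mu> n A \<ge> ennreal \<epsilon>} \<in> I)}"

(* P(N) with the topology of {0,1}^N, transported along characteristic functions. *)
definition cantor_topology :: "nat set topology" where
  "cantor_topology =
     pullback_topology (Pow Npos) (\<lambda>A. \<lambda>n\<in>Npos. n \<in> A)
       (product_topology (\<lambda>_. discrete_topology (UNIV :: bool set)) Npos)"

definition borel_in :: "'a topology \<Rightarrow> 'a set \<Rightarrow> bool" where
  "borel_in X S \<longleftrightarrow> S \<in> sigma_sets (topspace X) {U. openin X U}"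

definition baire_topology :: "(nat \<Rightarrow> nat) topology" where
  "baire_topology = product_topology (\<lambda>_. discrete_topology UNIV) UNIV"

(* Analytic sets of a Polish space: the empty set and the continuous images of Baire space. *)
definition analytic_in :: "'a topology \<Rightarrow> 'a set \<Rightarrow> bool" where
  "analytic_in X S \<longleftrightarrow>
     S = {} \<or> (\<exists>f. continuous_map baire_topology X f \<and> f ` topspace baire_topology = S)"

definition coanalytic_in :: "'a topology \<Rightarrow> 'a set \<Rightarrow> bool" where
  "coanalytic_in X S \<longleftrightarrow> S \<subseteq> topspace X \<and> analytic_in X (topspace X - S)"

lemma topspace_cantor_topology: "topspace cantor_topology = Pow Npos"
  by (auto simp: cantor_topology_def topspace_pullback_topology)

lemma ideal_J_ideal:
  assumes "ideal_on_N I" and "smooth_seq \<mu>"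
  shows "ideal_on_N (ideal_J I \<mu>)"
proof -
  have un: "\<And>A B. A \<in> I \<Longrightarrow> B \<in> I \<Longrightarrow> A \<union> B \<in> I"
    and down: "\<And>A B. B \<in> I \<Longrightarrow> A \<subseteq> B \<Longrightarrow> A \<in> I"
    and fin: "\<And>F. finite F \<Longrightarrow> F \<subseteq> Npos \<Longrightarrow> F \<in> I"
    using assms(1) unfolding ideal_on_N_def by blast+
  have sub: "\<And>n. n \<in> Npos \<Longrightarrow> submeasure (\<mu> n)"
    and S2: "\<And>k. k \<in> Npos \<Longrightarrow> (\<lambda>n. \<mu> n {k}) \<longlonglongrightarrow> 0"
    using assms(2) unfolding smooth_seq_def by blast+
  have J_un: "A \<union> B \<in> ideal_J I \<mu>" if A: "A \<in> ideal_J I \<mu>" and B: "B \<in> ideal_J I \<mu>" for A B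
  proof -
    have AB: "A \<subseteq> Npos" "B \<subseteq> Npos" using A B by (auto simp: ideal_J_def)
    have "{n\<in>Npos. \<mu> n (A \<union> B) \<ge> ennreal \<epsilon>} \<in> I" if e: "\<epsilon> > 0" for \<epsilon> :: real
    proof (rule down)
      show "{n\<in>Npos. \<mu> n A \<ge> ennreal (\<epsilon>/2)} \<union> {n\<in>Npos. \<mu> n B \<ge> ennreal (\<epsilon>/2)} \<in> I"
        using A B e by (intro un) (auto simp: ideal_J_def)
      show "{n\<in>Npos. \<mu> n (A \<union> B) \<ge> ennreal \<epsilon>} \<subseteq>
        {n\<in>Npos. \<mu> n A \<ge> ennreal (\<epsilon>/2)} \<union> {n\<in>Npos. \<mu> n B \<ge> ennreal (\<epsilon>/2)}"
      proof
        fix n assume n: "n \<in> {n\<in>Npos. \<mu> n (A \<union> B) \<ge> ennreal \<epsilon>}"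
        show "n \<in> {n\<in>Npos. \<mu> n A \<ge> ennreal (\<epsilon>/2)} \<union> {n\<in>Npos. \<mu> n B \<ge> ennreal (\<epsilon>/2)}"
        proof (rule ccontr)
          assume "\<not> ?thesis"
          then have "\<mu> n A < ennreal (\<epsilon>/2)" "\<mu> n B < ennreal (\<epsilon>/2)" using n by auto
          then have "\<mu> n A + \<mu> n B < ennreal (\<epsilon>/2 + \<epsilon>/2)" by (rule add_mono_ennreal)
          also have "\<dots> = ennreal \<epsilon>" by simp
          also have "\<dots> \<le> \<mu> n (A \<union> B)" using n by simp
          also have "\<dots> \<le> \<mu> n A + \<mu> n B" using sub[of n] n AB unfolding submeasure_def by blast
          finally show False by simp
        qed
      qed
    qed
    then show ?thesis using AB by (simp add: ideal_J_def)
  qed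
  have J_down: "A \<in> ideal_J I \<mu>" if B: "B \<in> ideal_J I \<mu>" and "A \<subseteq> B" for A B
  proof -
    have "B \<subseteq> Npos" using B by (simp add: ideal_J_def)
    have "\<mu> n A \<le> \<mu> n B" if "n \<in> Npos" for n
      using sub[OF that] \<open>A \<subseteq> B\<close> \<open>B \<subseteq> Npos\<close> unfolding submeasure_def by blast
    then have le: "{n\<in>Npos. \<mu> n A \<ge> ennreal \<epsilon>} \<subseteq> {n\<in>Npos. \<mu> n B \<ge> ennreal \<epsilon>}" for \<epsilon> :: real
      by (auto intro: order_trans)
    have inI: "{n\<in>Npos. \<mu> n B \<ge> ennreal \<epsilon>} \<in> I" if "\<epsilon> > 0" for \<epsilon> :: real
      using B that by (simp add: ideal_J_def)
    have "{n\<in>Npos. \<mu> n A \<ge> ennreal \<epsilon>} \<in> I" if "\<epsilon> > 0" for \<epsilon> :: real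
      by (rule down[OF inI[OF that] le])
    then show ?thesis using \<open>A \<subseteq> B\<close> \<open>B \<subseteq> Npos\<close> by (simp add: ideal_J_def)
  qed
  have J_single: "{k} \<in> ideal_J I \<mu>" if k: "k \<in> Npos" for k
  proof -
    have "{n\<in>Npos. \<mu> n {k} \<ge> ennreal \<epsilon>} \<in> I" if e: "\<epsilon> > 0" for \<epsilon> :: real
    proof (rule fin)
      have "\<forall>\<^sub>F n in sequentially. \<mu> n {k} < ennreal \<epsilon>"
        using order_tendstoD(2)[OF S2[OF k]] e by simp
      then obtain N where "\<And>n. n \<ge> N \<Longrightarrow> \<mu> n {k} < ennreal \<epsilon>"
        by (auto simp: eventually_sequentially)
      then have "{n\<in>Npos. \<mu> n {k} \<ge> ennreal \<epsilon>} \<subseteq> {..<N}"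
        by (force simp: not_le[symmetric])
      then show "finite {n\<in>Npos. \<mu> n {k} \<ge> ennreal \<epsilon>}" by (rule finite_subset) simp
    qed auto
    then show ?thesis using k by (simp add: ideal_J_def)
  qed
  have J_fin: "F \<in> ideal_J I \<mu>" if "finite F" "F \<subseteq> Npos" for F
    using that
  proof (induction F)
    case empty
    show ?case by (rule J_down[OF J_single[of 1]]) auto
  next
    case (insert k F)
    then show ?case using J_un[OF J_single[of k], of F] by simp
  qed
  have "ideal_J I \<mu> \<subseteq> Pow Npos" by (auto simp: ideal_J_def)
  then show ?thesis
    unfolding ideal_on_N_def by (intro conjI allI impI) (use J_un J_down J_fin in \<open>blast+\<close>)
qed

end

theory Submission
  imports Defs
begin

text \<open>Put \<open>f\<^sub>k A = {n. \<mu>\<^sub>n A > 1 / (k + 1)}\<close>, so that \<open>A \<in> \<J>\<close> iff \<open>f\<^sub>k A \<in> \<I>\<close> for all \<open>k\<close>.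
  By lower semicontinuity each set \<open>{A. \<mu>\<^sub>n A > c}\<close> is open, so every \<open>f\<^sub>k\<close> is a Borel map, which
  settles the Borel case. For the other two cases the monotonicity of \<open>\<I>\<close> replaces the equation
  \<open>B = f\<^sub>k A\<close> by an inclusion. First, \<open>A \<in> \<J>\<close> iff there are \<open>B\<^sub>k \<in> \<I>\<close> with \<open>f\<^sub>k A \<subseteq> B\<^sub>k\<close> for all \<open>k\<close>,
  a closed condition on \<open>(A, (B\<^sub>k)\<^sub>k)\<close>. Second, \<open>A \<notin> \<J>\<close> iff there are \<open>k\<close>, \<open>B \<notin> \<I>\<close> and
  \<open>h : \<nat> \<rightarrow> \<nat>\<close> with \<open>\<mu>\<^sub>n (A \<inter> [1, h n]) > 1 / (k + 1)\<close> for all \<open>n \<in> B\<close>, a closed condition on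
  \<open>(A, k, B, h)\<close>. Parametrising \<open>\<I>\<close> or its complement by Baire space, both sets become
  continuous images of closed subsets of Baire space, and nonempty closed subsets of Baire space
  are retracts of it.\<close>

section \<open>Baire space\<close>

lemma baire_topology_eq_euclidean: "baire_topology = euclidean"
proof -
  have "discrete_topology (UNIV :: nat set) = euclidean"
    by (simp add: topology_eq open_discrete)
  then show ?thesis
    unfolding baire_topology_def using euclidean_product_topology by metis
qed

text \<open>A basic open set of the product restricts finitely many coordinates, so around each of
  its points it contains the prefix cylinder cut at a bound for them; conversely, prefix cylinders
  are open.\<close>

lemma open_baire_iff:
  fixes U :: "(nat \<Rightarrow> nat) set"
  shows "open U \<longleftrightarrow> (\<forall>x\<in>U. \<exists>n. \<forall>y. (\<forall>i<n. y i = x i) \<longrightarrow> y \<in> U)"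
proof (intro iffI ballI)
  fix x assume "open U" "x \<in> U"
  then have "openin (product_topology (\<lambda>_. discrete_topology UNIV) UNIV) U"
    using baire_topology_eq_euclidean by (simp add: baire_topology_def)
  from product_topology_open_contains_basis[OF this \<open>x \<in> U\<close>]
  obtain X where X: "x \<in> (\<Pi>\<^sub>E i\<in>UNIV. X i)" "finite {i. X i \<noteq> UNIV}" "(\<Pi>\<^sub>E i\<in>UNIV. X i) \<subseteq> U"
    by auto
  then obtain n where n: "\<And>i. X i \<noteq> UNIV \<Longrightarrow> i < n"
    using finite_nat_set_iff_bounded by auto
  have "y \<in> U" if "\<forall>i<n. y i = x i" for y
  proof -
    have "y i \<in> X i" for i
      using X(1) n[of i] that by (cases "X i = UNIV") (auto simp: PiE_iff)
    then show ?thesis using X(3) by (auto simp: PiE_iff)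
  qed
  then show "\<exists>n. \<forall>y. (\<forall>i<n. y i = x i) \<longrightarrow> y \<in> U" by blast
next
  assume U: "\<forall>x\<in>U. \<exists>n. \<forall>y. (\<forall>i<n. y i = x i) \<longrightarrow> y \<in> U"
  show "open U"
  proof (subst open_subopen, intro ballI)
    fix x assume "x \<in> U"
    then obtain n where n: "\<forall>y. (\<forall>i<n. y i = x i) \<longrightarrow> y \<in> U" using U by blast
    have "open {y. \<forall>i\<in>{..<n}. y i \<in> {x i}}"
      by (rule product_topology_basis'[of "{..<n}" "\<lambda>i. {x i}" "\<lambda>i. i"])
        (auto simp: open_discrete)
    then show "\<exists>T. open T \<and> x \<in> T \<and> T \<subseteq> U"
      using n by (intro exI[of _ "{y. \<forall>i\<in>{..<n}. y i \<in> {x i}}"]) auto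
  qed
qed

lemma continuous_on_baireI:
  fixes r :: "(nat \<Rightarrow> nat) \<Rightarrow> nat \<Rightarrow> nat"
  assumes "\<And>x m. \<exists>n. \<forall>y. (\<forall>i<n. y i = x i) \<longrightarrow> (\<forall>i<m. r y i = r x i)"
  shows "continuous_on UNIV r"
proof -
  have "open (r -` U)" if "open U" for U
    unfolding open_baire_iff
  proof
    fix x assume "x \<in> r -` U"
    then obtain m where m: "\<forall>z. (\<forall>i<m. z i = r x i) \<longrightarrow> z \<in> U"
      using \<open>open U\<close> unfolding open_baire_iff by blast
    obtain n where n: "\<forall>y. (\<forall>i<n. y i = x i) \<longrightarrow> (\<forall>i<m. r y i = r x i)"
      using assms by blast
    have "y \<in> r -` U" if "\<forall>i<n. y i = x i" for y
      using m[rule_format, of "r y"] n[rule_format, OF that[rule_format]] by simp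
    then show "\<exists>n. \<forall>y. (\<forall>i<n. y i = x i) \<longrightarrow> y \<in> r -` U" by (intro exI allI impI)
  qed
  then show ?thesis by (simp add: continuous_on_open_vimage)
qed

text \<open>A point \<open>x\<close> outside \<open>C\<close> is sent to a point of \<open>C\<close> that depends only on the longest prefix
  of \<open>x\<close> extendible within \<open>C\<close>.\<close>
lemma closed_baire_retract:
  fixes C :: "(nat \<Rightarrow> nat) set"
  assumes "closed C" "C \<noteq> {}"
  obtains r :: "(nat \<Rightarrow> nat) \<Rightarrow> nat \<Rightarrow> nat" where "continuous_on UNIV r" "range r = C"
proof -
  define ext where "ext x n \<longleftrightarrow> (\<exists>c\<in>C. \<forall>i<n. c i = x i)" for x :: "nat \<Rightarrow> nat" and n
  \<comment> \<open>Meaningful only for \<open>x\<close> outside \<open>C\<close>, where closedness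
    bounds the extendible prefixes. For \<open>x\<close> in \<open>C\<close> every prefix is
    extendible, and \<open>r\<close> does not consult \<open>len\<close>.\<close>
  define len where "len x = (GREATEST n. ext x n)" for x
  define pick where "pick p = (SOME c. c \<in> C \<and> (\<forall>i<length p. c i = p ! i))" for p :: "nat list"
  define r where "r x = (if x \<in> C then x else pick (map x [0..<len x]))" for x
  have ext0: "ext x 0" for x using assms(2) by (auto simp: ext_def)
  have ext_mono: "ext x m" if "ext x n" "m \<le> n" for x m n
    using that unfolding ext_def by (meson less_le_trans)
  have ext_cong: "ext y m \<longleftrightarrow> ext x m" if "\<forall>i<n. y i = x i" "m \<le> n" for x y m n
    using that unfolding ext_def by auto
  have bound: "\<exists>n. \<not> ext x n" if "x \<notin> C" for x
  proof -
    have "open (- C)" using assms(1) by (simp add: open_Compl)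
    then have "\<exists>n. \<forall>y. (\<forall>i<n. y i = x i) \<longrightarrow> y \<in> - C"
      unfolding open_baire_iff by (rule bspec) (use that in simp)
    then obtain n where "\<forall>y. (\<forall>i<n. y i = x i) \<longrightarrow> y \<in> - C" by (rule exE)
    then have "\<not> ext x n" by (auto simp: ext_def)
    then show ?thesis by (rule exI)
  qed
  have len: "ext x (len x)" "\<And>m. ext x m \<Longrightarrow> m \<le> len x" if x: "x \<notin> C" for x
  proof -
    obtain n where n: "\<not> ext x n" using bound[OF x] by blast
    have le: "m \<le> n" if "ext x m" for m using ext_mono[OF that, of n] n by (meson linear)
    show "ext x (len x)" unfolding len_def by (rule GreatestI_nat[where P = "ext x", OF ext0]) (use le in auto)
    show "m \<le> len x" if "ext x m" for m
      unfolding len_def by (rule Greatest_le_nat[where P = "ext x", OF that]) (use le in auto)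
  qed
  have pick: "pick (map x [0..<n]) \<in> C \<and> (\<forall>i<n. pick (map x [0..<n]) i = x i)"
    if "ext x n" for x n
  proof -
    have "\<exists>c. c \<in> C \<and> (\<forall>i<length (map x [0..<n]). c i = map x [0..<n] ! i)"
      using that by (auto simp: ext_def)
    from someI_ex[OF this] show ?thesis unfolding pick_def by auto
  qed
  have rC: "r x \<in> C" for x using pick[OF len(1)] by (simp add: r_def)
  have r_agree: "r x i = x i" if "ext x n" "i < n" for x n i
  proof (cases "x \<in> C")
    case False
    then have "i < len x" using len(2)[OF False that(1)] that(2) by simp
    then show ?thesis using pick[OF len(1)[OF False]] False by (simp add: r_def)
  qed (simp add: r_def)
  have "continuous_on UNIV r"
  proof (rule continuous_on_baireI)
    fix x m
    show "\<exists>n. \<forall>y. (\<forall>i<n. y i = x i) \<longrightarrow> (\<forall>i<m. r y i = r x i)"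
    proof (cases "x \<in> C")
      case True
      \<comment> \<open>If \<open>y\<close> shares its first \<open>m\<close> values with a point of
        \<open>C\<close>, its prefix of length \<open>m\<close> is extendible, and \<open>r\<close>
        leaves extendible prefixes unchanged.\<close>
      have "r y i = r x i" if "\<forall>i<m. y i = x i" "i < m" for y i
      proof -
        have "ext y m" using True that(1) by (auto simp: ext_def)
        then show ?thesis using r_agree that True by (simp add: r_def)
      qed
      then show ?thesis by blast
    next
      case False
      \<comment> \<open>One value beyond the longest extendible prefix of \<open>x\<close> certifies
        that it cannot be prolonged. So \<open>y\<close> has the same longest prefix, and
        \<open>r\<close> is locally constant off \<open>C\<close>.\<close>
      have "r y = r x" if y: "\<forall>i<Suc (len x). y i = x i" for y
      proof -
        have not: "\<not> ext y (Suc (len x))" using ext_cong[OF y] len(2)[OF False] by fastforce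
        then have "y \<notin> C" by (auto simp: ext_def)
        have "ext y (len x)" using ext_cong[OF y] len(1)[OF False] by simp
        then have "len x \<le> len y" using len(2)[OF \<open>y \<notin> C\<close>] by blast
        moreover have "len y \<le> len x"
          using ext_mono[OF len(1)[OF \<open>y \<notin> C\<close>]] not by (meson not_less_eq_eq)
        ultimately have "len y = len x" by simp
        moreover have "map y [0..<len x] = map x [0..<len x]" using y by simp
        ultimately show ?thesis using \<open>y \<notin> C\<close> False by (simp add: r_def del: map_eq_conv)
      qed
      then show ?thesis by metis
    qed
  qed
  moreover have "range r = C"
  proof
    show "range r \<subseteq> C" using rC by blast
    have "x = r x" if "x \<in> C" for x using that by (simp add: r_def)
    then show "C \<subseteq> range r" by blast
  qed
  ultimately show ?thesis using that by blast
qed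

text \<open>\<open>analytic_in\<close> asks for a map on the whole of Baire space; precomposing
  \<open>F\<close> with a retraction onto \<open>C\<close> provides it, and an empty
  \<open>C\<close> falls under the separate clause of the definition.\<close>

lemma analytic_in_image_closed:
  fixes C :: "(nat \<Rightarrow> nat) set"
  assumes "closed C" "continuous_map euclidean X F"
  shows "analytic_in X (F ` C)"
proof (cases "C = {}")
  case False
  then obtain r :: "(nat \<Rightarrow> nat) \<Rightarrow> nat \<Rightarrow> nat" where r: "continuous_on UNIV r" "range r = C"
    by (rule closed_baire_retract[OF assms(1)])
  have "continuous_map euclidean X (F \<circ> r)"
    using r(1) assms(2) by (intro continuous_map_compose[of _ euclidean]) auto
  moreover have "(F \<circ> r) ` UNIV = F ` C" using r(2) by (metis image_comp)
  ultimately show ?thesis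
    unfolding analytic_in_def baire_topology_eq_euclidean topspace_euclidean by blast
qed (simp add: analytic_in_def)

lemma open_coordinate: "open {x :: nat \<Rightarrow> nat. P (x j)}"
  unfolding open_baire_iff by (auto intro!: exI[of _ "Suc j"])

lemma continuous_map_reindex:
  fixes \<sigma> :: "nat \<Rightarrow> nat"
  shows "continuous_map euclidean euclidean (\<lambda>(x :: nat \<Rightarrow> nat) n. x (\<sigma> n))"
  by (simp add: continuous_on_coordinatewise_then_product continuous_on_product_coordinates)

section \<open>Cantor space\<close>

text \<open>Finitely many discrete coordinates decide membership. Since \<open>P\<close> is
  arbitrary, the complement has the same shape, so these sets are in fact clopen.\<close>

lemma openin_cantor_finite_part:
  "openin cantor_topology {A. A \<subseteq> Npos \<and> P (A \<inter> {1..m})}"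
proof -
  let ?T = "product_topology (\<lambda>_. discrete_topology (UNIV :: bool set)) Npos"
  define U where "U = {f \<in> Npos \<rightarrow>\<^sub>E (UNIV :: bool set). P {n\<in>{1..m}. f n}}"
  have "openin ?T U"
    unfolding openin_product_topology_alt
  proof
    fix f assume f: "f \<in> U"
    define V where "V i = (if i \<in> {1..m} then {f i} else UNIV)" for i
    have "{i \<in> Npos. V i \<noteq> UNIV} \<subseteq> {1..m}" by (auto simp: V_def)
    then have "finite {i \<in> Npos. V i \<noteq> topspace (discrete_topology UNIV)}"
      using finite_subset by auto
    moreover have "f \<in> Pi\<^sub>E Npos V" using f by (auto simp: U_def V_def PiE_iff)
    moreover have "Pi\<^sub>E Npos V \<subseteq> U"
    proof
      fix g assume g: "g \<in> Pi\<^sub>E Npos V"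
      then have "g n = f n" if "n \<in> {1..m}" for n
        using that by (auto simp: V_def PiE_iff split: if_splits)
      then have "{n\<in>{1..m}. g n} = {n\<in>{1..m}. f n}" by blast
      then show "g \<in> U" using f g by (auto simp: U_def PiE_iff)
    qed
    ultimately show "\<exists>V. finite {i \<in> Npos. V i \<noteq> topspace (discrete_topology UNIV)} \<and>
        (\<forall>i\<in>Npos. openin (discrete_topology UNIV) (V i)) \<and> f \<in> Pi\<^sub>E Npos V \<and> Pi\<^sub>E Npos V \<subseteq> U"
      by (intro exI[of _ V]) auto
  qed
  moreover have "{A. A \<subseteq> Npos \<and> P (A \<inter> {1..m})} = (\<lambda>A. \<lambda>n\<in>Npos. n \<in> A) -` U \<inter> Pow Npos"
  proof -
    have "{n\<in>{1..m}. (\<lambda>n\<in>Npos. n \<in> A) n} = A \<inter> {1..m}" for A by auto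
    then show ?thesis by (auto simp: U_def)
  qed
  ultimately show ?thesis
    unfolding cantor_topology_def openin_pullback_topology by blast
qed

lemma openin_cantor_prefix:
  assumes "openin cantor_topology U" "A \<in> U"
  obtains m where "\<And>B. B \<subseteq> Npos \<Longrightarrow> B \<inter> {1..m} = A \<inter> {1..m} \<Longrightarrow> B \<in> U"
proof -
  let ?\<chi> = "\<lambda>A. \<lambda>n\<in>Npos. n \<in> A"
  obtain V where V: "openin (product_topology (\<lambda>_. discrete_topology (UNIV :: bool set)) Npos) V"
    "U = ?\<chi> -` V \<inter> Pow Npos"
    using assms(1) unfolding cantor_topology_def openin_pullback_topology by blast
  have "?\<chi> A \<in> V" using assms(2) V(2) by blast
  from product_topology_open_contains_basis[OF V(1) this]
  obtain X where X: "?\<chi> A \<in> (\<Pi>\<^sub>E i\<in>Npos. X i)" "finite {i. X i \<noteq> UNIV}" "(\<Pi>\<^sub>E i\<in>Npos. X i) \<subseteq> V"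
    by auto
  obtain m where m: "\<And>i. X i \<noteq> UNIV \<Longrightarrow> i \<le> m"
    using X(2) finite_nat_set_iff_bounded_le by auto
  have "B \<in> U" if "B \<subseteq> Npos" "B \<inter> {1..m} = A \<inter> {1..m}" for B
  proof -
    have "?\<chi> B i \<in> X i" if i: "i \<in> Npos" for i
    proof (cases "X i = UNIV")
      case False
      then have "i \<in> {1..m}" using m i by simp
      then have "i \<in> B \<longleftrightarrow> i \<in> A" using \<open>B \<inter> {1..m} = A \<inter> {1..m}\<close> by blast
      then show ?thesis using X(1) i by (auto simp: PiE_iff)
    qed simp
    then have "?\<chi> B \<in> (\<Pi>\<^sub>E i\<in>Npos. X i)" by (auto simp: PiE_iff)
    then show ?thesis using V(2) X(3) \<open>B \<subseteq> Npos\<close> by blast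
  qed
  then show ?thesis using that by blast
qed

text \<open>Continuity into a product is tested coordinatewise, and a map into discrete
  \<open>bool\<close> is continuous once both fibres are open.\<close>

lemma continuous_map_cantorI:
  assumes "\<And>x. x \<in> topspace X \<Longrightarrow> F x \<subseteq> Npos"
    and "\<And>n. n \<in> Npos \<Longrightarrow> openin X {x \<in> topspace X. n \<in> F x}"
    and "\<And>n. n \<in> Npos \<Longrightarrow> openin X {x \<in> topspace X. n \<notin> F x}"
  shows "continuous_map X cantor_topology F"
  unfolding cantor_topology_def
proof (rule continuous_map_pullback')
  have "continuous_map X (discrete_topology (UNIV :: bool set)) (\<lambda>x. n \<in> F x)"
    if n: "n \<in> Npos" for n
    unfolding continuous_map_def
  proof (intro conjI allI impI)
    fix U :: "bool set"
    have "{x \<in> topspace X. (n \<in> F x) \<in> U} =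
        (if True \<in> U then {x \<in> topspace X. n \<in> F x} else {}) \<union>
        (if False \<in> U then {x \<in> topspace X. n \<notin> F x} else {})"
      by auto (metis (full_types))+
    then show "openin X {x \<in> topspace X. (n \<in> F x) \<in> U}"
      using assms(2,3)[OF n] by auto
  qed auto
  then show "continuous_map X (product_topology (\<lambda>_. discrete_topology (UNIV :: bool set)) Npos)
      ((\<lambda>A. \<lambda>n\<in>Npos. n \<in> A) \<circ> F)"
    unfolding continuous_map_componentwise by auto
  show "topspace X \<subseteq> F -` Pow Npos" using assms(1) by auto
qed

lemma
  fixes F :: "'a::topological_space \<Rightarrow> nat set"
  assumes F: "continuous_map euclidean cantor_topology F"
  shows open_cantor_map_finite_part: "open {x. P (F x \<inter> {1..m})}"
    and closed_cantor_map_finite_part: "closed {x. P (F x \<inter> {1..m})}"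
proof -
  have "F x \<subseteq> Npos" for x
    using F unfolding continuous_map_def topspace_cantor_topology by auto
  then have *: "open {x. Q (F x \<inter> {1..m})}" for Q
    using openin_continuous_map_preimage[OF F openin_cantor_finite_part[of Q m]] by simp
  show "open {x. P (F x \<inter> {1..m})}" by (rule *)
  have "{x. P (F x \<inter> {1..m})} = - {x. \<not> P (F x \<inter> {1..m})}" by blast
  then show "closed {x. P (F x \<inter> {1..m})}" using *[of "\<lambda>S. \<not> P S"] by (simp add: closed_def)
qed

lemma
  fixes F :: "'a::topological_space \<Rightarrow> nat set"
  assumes F: "continuous_map euclidean cantor_topology F" and n: "n \<in> Npos"
  shows open_cantor_map_mem: "open {x. n \<in> F x}"
    and closed_cantor_map_mem: "closed {x. n \<in> F x}"
proof -
  have "n \<in> F x \<longleftrightarrow> n \<in> F x \<inter> {1..n}" for x using n by auto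
  then show "open {x. n \<in> F x}" "closed {x. n \<in> F x}"
    using open_cantor_map_finite_part[OF F, of "\<lambda>S. n \<in> S" n]
      closed_cantor_map_finite_part[OF F, of "\<lambda>S. n \<in> S" n] by simp_all
qed

section \<open>Borel sets of Cantor space and measurable maps into it\<close>

definition cantor_borel :: "nat set measure" where
  "cantor_borel = sigma (Pow Npos) {U. openin cantor_topology U}"

lemma openin_cantor_subset: "{U. openin cantor_topology U} \<subseteq> Pow (Pow Npos)"
  using openin_subset[of cantor_topology] unfolding topspace_cantor_topology by blast

lemma space_cantor_borel: "space cantor_borel = Pow Npos"
  unfolding cantor_borel_def by (rule space_measure_of[OF openin_cantor_subset])

lemma borel_in_cantor_iff: "borel_in cantor_topology S \<longleftrightarrow> S \<in> sets cantor_borel"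
  unfolding borel_in_def topspace_cantor_topology cantor_borel_def
  unfolding sets_measure_of[OF openin_cantor_subset] by (rule refl)

lemma borel_in_openin: "openin X U \<Longrightarrow> borel_in X U"
  unfolding borel_in_def by (simp add: sigma_sets.Basic)

text \<open>Every open set is a countable union of cylinders, and the preimage of a cylinder is a
  finite Boolean combination of the sets in \<open>meas\<close>.\<close>

lemma measurable_cantorI:
  assumes F: "F \<in> space M \<rightarrow> Pow Npos"
    and meas: "\<And>n. n \<in> Npos \<Longrightarrow> {x \<in> space M. n \<in> F x} \<in> sets M"
  shows "F \<in> measurable M cantor_borel"
  unfolding cantor_borel_def
proof (rule measurable_measure_of[OF openin_cantor_subset F])
  fix U assume "U \<in> {U. openin cantor_topology U}"
  then have U: "openin cantor_topology U" by simp
  define cyl where "cyl m S = {x \<in> space M. F x \<inter> {1..m} = S}" for m :: nat and S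
  have cyl: "cyl m S \<in> sets M" if "S \<subseteq> {1..m}" for m S
  proof -
    have "cyl m S = {x \<in> space M. \<forall>n\<in>{1..m}. n \<in> F x \<longleftrightarrow> n \<in> S}"
      using that by (auto simp: cyl_def)
    also have "\<dots> \<in> sets M"
    proof (rule sets.sets_Collect_finite_All)
      fix n assume "n \<in> {1..m}"
      then have n: "{x \<in> space M. n \<in> F x} \<in> sets M" using meas by simp
      show "{x \<in> space M. n \<in> F x \<longleftrightarrow> n \<in> S} \<in> sets M"
        using n sets.sets_Collect_neg[OF n] by (cases "n \<in> S") simp_all
    qed auto
    finally show ?thesis .
  qed
  \<comment> \<open>\<open>K m\<close> collects the traces on \<open>{1..m}\<close> whose whole
    cylinder lies in \<open>U\<close>. There are finitely many for each \<open>m\<close>, and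
    openness of \<open>U\<close> makes their cylinders cover it.\<close>
  define K where "K m = {S. S \<subseteq> {1..m} \<and> (\<forall>B\<subseteq>Npos. B \<inter> {1..m} = S \<longrightarrow> B \<in> U)}" for m :: nat
  have "F -` U \<inter> space M = (\<Union>m. \<Union>S\<in>K m. cyl m S)"
  proof (intro set_eqI iffI)
    fix x assume x: "x \<in> F -` U \<inter> space M"
    obtain m where "\<And>B. B \<subseteq> Npos \<Longrightarrow> B \<inter> {1..m} = F x \<inter> {1..m} \<Longrightarrow> B \<in> U"
      using openin_cantor_prefix[OF U, of "F x"] x by blast
    then have "F x \<inter> {1..m} \<in> K m" by (auto simp: K_def)
    then show "x \<in> (\<Union>m. \<Union>S\<in>K m. cyl m S)" using x by (auto simp: cyl_def)
  next
    fix x assume "x \<in> (\<Union>m. \<Union>S\<in>K m. cyl m S)"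
    then show "x \<in> F -` U \<inter> space M" using F by (auto simp: cyl_def K_def)
  qed
  moreover have "finite (K m)" for m by (rule finite_subset[of _ "Pow {1..m}"]) (auto simp: K_def)
  moreover have "cyl m S \<in> sets M" if "S \<in> K m" for m S using that cyl by (auto simp: K_def)
  ultimately show "F -` U \<inter> space M \<in> sets M"
    by (auto intro!: sets.countable_UN sets.finite_UN)
qed

section \<open>Lower semicontinuous submeasures\<close>

text \<open>Monotonicity gives one direction, passage to the limit the other:
  \<open>\<phi> A\<close> is the supremum of its values on the finite initial segments of
  \<open>A\<close>.\<close>

lemma lsc_submeasure_le_iff:
  assumes "lsc_submeasure \<phi>" "A \<subseteq> Npos"
  shows "\<phi> A \<le> c \<longleftrightarrow> (\<forall>m. \<phi> (A \<inter> {1..m}) \<le> c)"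
proof
  assume "\<phi> A \<le> c"
  moreover have "\<phi> (A \<inter> {1..m}) \<le> \<phi> A" for m
    using assms unfolding lsc_submeasure_def submeasure_def by (meson inf_le1)
  ultimately show "\<forall>m. \<phi> (A \<inter> {1..m}) \<le> c" using order_trans by blast
next
  assume "\<forall>m. \<phi> (A \<inter> {1..m}) \<le> c"
  moreover have "(\<lambda>m. \<phi> (A \<inter> {1..m})) \<longlonglongrightarrow> \<phi> A"
    using assms unfolding lsc_submeasure_def by blast
  ultimately show "\<phi> A \<le> c" by (intro LIMSEQ_le_const2) auto
qed

lemma lsc_submeasure_gt_iff:
  assumes "lsc_submeasure \<phi>" "A \<subseteq> Npos"
  shows "c < \<phi> A \<longleftrightarrow> (\<exists>m. c < \<phi> (A \<inter> {1..m}))"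
  using lsc_submeasure_le_iff[OF assms, of c] by (metis not_le)

lemma openin_cantor_lsc_gt:
  assumes "lsc_submeasure \<phi>"
  shows "openin cantor_topology {A. A \<subseteq> Npos \<and> c < \<phi> A}"
proof -
  have "{A. A \<subseteq> Npos \<and> c < \<phi> A} = (\<Union>m. {A. A \<subseteq> Npos \<and> c < \<phi> (A \<inter> {1..m})})"
    using lsc_submeasure_gt_iff[OF assms, of _ c] by auto
  then show ?thesis
    using openin_cantor_finite_part[of "\<lambda>S. c < \<phi> S"] by (auto intro: openin_clauses(3))
qed

section \<open>The ideal \<open>\<J>(\<I>, \<mu>)\<close>\<close>

text \<open>The inequality is strict because, by lower semicontinuity, a strict lower bound on
  \<open>\<mu> n A\<close> is already witnessed by a finite initial segment of
  \<open>A\<close>.\<close>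

definition large_indices :: "(nat \<Rightarrow> nat set \<Rightarrow> ennreal) \<Rightarrow> nat \<Rightarrow> nat set \<Rightarrow> nat set" where
  "large_indices \<mu> k A = {n\<in>Npos. ennreal (1 / Suc k) < \<mu> n A}"

text \<open>For \<open>1 / Suc k < \<epsilon>\<close> the set of large indices lies between the sets
  given by \<open>\<ge> \<epsilon>\<close> and \<open>\<ge> 1 / Suc k\<close>, and \<open>I\<close>
  is closed under subsets.\<close>

lemma ideal_J_iff_large_indices:
  assumes "ideal_on_N I"
  shows "A \<in> ideal_J I \<mu> \<longleftrightarrow> A \<subseteq> Npos \<and> (\<forall>k. large_indices \<mu> k A \<in> I)"
proof (intro iffI conjI allI)
  have down: "\<And>A B. B \<in> I \<Longrightarrow> A \<subseteq> B \<Longrightarrow> A \<in> I"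
    using assms unfolding ideal_on_N_def by blast
  show "A \<subseteq> Npos" if "A \<in> ideal_J I \<mu>" using that by (simp add: ideal_J_def)
  show "large_indices \<mu> k A \<in> I" if A: "A \<in> ideal_J I \<mu>" for k
  proof (rule down)
    show "{n\<in>Npos. \<mu> n A \<ge> ennreal (1 / Suc k)} \<in> I"
      using A unfolding ideal_J_def by simp
  qed (auto simp: large_indices_def)
  assume A: "A \<subseteq> Npos \<and> (\<forall>k. large_indices \<mu> k A \<in> I)"
  have "{n\<in>Npos. \<mu> n A \<ge> ennreal \<epsilon>} \<in> I" if "\<epsilon> > 0" for \<epsilon> :: real
  proof -
    obtain k where k: "1 / Suc k < \<epsilon>" using nat_approx_posE[OF \<open>\<epsilon> > 0\<close>] by metis
    then have "ennreal (1 / Suc k) < ennreal \<epsilon>" using that by (intro ennreal_lessI)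
    then have "{n\<in>Npos. \<mu> n A \<ge> ennreal \<epsilon>} \<subseteq> large_indices \<mu> k A"
      by (auto simp: large_indices_def)
    then show ?thesis using A down by blast
  qed
  then show "A \<in> ideal_J I \<mu>" using A by (simp add: ideal_J_def)
qed

section \<open>The Borel case\<close>

lemma borel_in_ideal_J:
  assumes "ideal_on_N I" "\<forall>n\<in>Npos. lsc_submeasure (\<mu> n)" "borel_in cantor_topology I"
  shows "borel_in cantor_topology (ideal_J I \<mu>)"
proof -
  have meas: "large_indices \<mu> k \<in> measurable cantor_borel cantor_borel" for k
  proof (rule measurable_cantorI)
    fix n assume n: "n \<in> Npos"
    have "{A \<in> space cantor_borel. n \<in> large_indices \<mu> k A} =
        {A. A \<subseteq> Npos \<and> ennreal (1 / Suc k) < \<mu> n A}"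
      unfolding space_cantor_borel using n by (auto simp: large_indices_def)
    moreover have "openin cantor_topology \<dots>" using openin_cantor_lsc_gt assms(2) n by blast
    ultimately show "{A \<in> space cantor_borel. n \<in> large_indices \<mu> k A} \<in> sets cantor_borel"
      using borel_in_openin borel_in_cantor_iff by metis
  qed (auto simp: large_indices_def)
  have "ideal_J I \<mu> = (\<Inter>k. large_indices \<mu> k -` I \<inter> space cantor_borel)"
    unfolding space_cantor_borel using ideal_J_iff_large_indices[OF assms(1)] by auto
  moreover have "large_indices \<mu> k -` I \<inter> space cantor_borel \<in> sets cantor_borel" for k
    using measurable_sets[OF meas] assms(3) by (simp add: borel_in_cantor_iff)
  then have "(\<Inter>k. large_indices \<mu> k -` I \<inter> space cantor_borel) \<in> sets cantor_borel"
    by (intro sets.countable_INT) auto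
  ultimately show ?thesis unfolding borel_in_cantor_iff by metis
qed

text \<open>Baire space is read as the space of \<open>\<nat>\<close>-indexed families of its own points; the \<open>0\<close>-th
  member codes the set \<open>A\<close>, the others the witnesses.\<close>

definition slice :: "nat \<Rightarrow> (nat \<Rightarrow> nat) \<Rightarrow> nat \<Rightarrow> nat" where
  "slice k x = (\<lambda>n. x (prod_encode (k, n)))"

text \<open>The value 0 codes membership and every other value non-membership, which maps Baire
  space continuously onto Cantor space.\<close>

definition zero_set :: "(nat \<Rightarrow> nat) \<Rightarrow> nat set" where
  "zero_set x = {n\<in>Npos. x n = 0}"

lemma continuous_map_slice: "continuous_map euclidean euclidean (slice k)"
  unfolding slice_def by (rule continuous_map_reindex)

definition unslice :: "(nat \<Rightarrow> nat \<Rightarrow> nat) \<Rightarrow> nat \<Rightarrow> nat" where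
  "unslice y = (\<lambda>j. case prod_decode j of (k, n) \<Rightarrow> y k n)"

lemma slice_unslice: "slice k (unslice y) = y k"
  by (simp add: slice_def unslice_def)

lemma continuous_map_zero_set: "continuous_map euclidean cantor_topology zero_set"
  using open_coordinate[of "\<lambda>i. i = 0"] open_coordinate[of "\<lambda>i. i \<noteq> 0"]
  by (intro continuous_map_cantorI) (auto simp: zero_set_def)

lemma zero_set_surj:
  assumes "A \<subseteq> Npos"
  shows "zero_set (\<lambda>n. if n \<in> A then 0 else 1) = A"
  using assms by (auto simp: zero_set_def)

section \<open>The analytic and coanalytic cases\<close>

lemma closed_cantor_map_lsc_le:
  fixes F :: "'a::topological_space \<Rightarrow> nat set"
  assumes F: "continuous_map euclidean cantor_topology F" and "lsc_submeasure \<phi>"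
  shows "closed {x. \<phi> (F x) \<le> c}"
proof -
  have "F x \<subseteq> Npos" for x
    using F unfolding continuous_map_def topspace_cantor_topology by auto
  \<comment> \<open>An intersection over \<open>m\<close> of conditions on finite parts of
    \<open>F x\<close>, each of them clopen.\<close>
  then have "{x. \<phi> (F x) \<le> c} = {x. \<forall>m. \<phi> (F x \<inter> {1..m}) \<le> c}"
    using lsc_submeasure_le_iff[OF assms(2)] by simp
  then show ?thesis
    using closed_cantor_map_finite_part[OF F, of "\<lambda>S. \<phi> S \<le> c"] by (simp add: closed_Collect_all)
qed

lemma analytic_in_ideal_J:
  assumes "ideal_on_N I" "\<forall>n\<in>Npos. lsc_submeasure (\<mu> n)" "analytic_in cantor_topology I"
  shows "analytic_in cantor_topology (ideal_J I \<mu>)"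
proof -
  have "{} \<in> I" and down: "\<And>A B. B \<in> I \<Longrightarrow> A \<subseteq> B \<Longrightarrow> A \<in> I"
    using assms(1) unfolding ideal_on_N_def by blast+
  \<comment> \<open>\<open>{} \<in> I\<close> rules out the clause of \<open>analytic_in\<close> for
    the empty set.\<close>
  then obtain g :: "(nat \<Rightarrow> nat) \<Rightarrow> nat set" where g: "continuous_map euclidean cantor_topology g" "range g = I"
    using assms(3) unfolding analytic_in_def baire_topology_eq_euclidean by auto
  define A where "A = zero_set \<circ> slice 0"
  define B where "B k = g \<circ> slice (Suc k)" for k
  \<comment> \<open>The inclusion of \<open>large_indices \<mu> k (A x)\<close> in
    \<open>B k x\<close>, written as a disjunction of closed conditions for each
    \<open>n\<close>.\<close>
  define C where "C = (\<Inter>k. \<Inter>n\<in>Npos. {x. n \<in> B k x \<or> \<mu> n (A x) \<le> ennreal (1 / Suc k)})"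
  have contA: "continuous_map euclidean cantor_topology A"
    unfolding A_def by (rule continuous_map_compose[OF continuous_map_slice continuous_map_zero_set])
  have contB: "continuous_map euclidean cantor_topology (B k)" for k
    unfolding B_def by (rule continuous_map_compose[OF continuous_map_slice g(1)])
  have "closed C"
    unfolding C_def using assms(2)
    by (intro closed_INT ballI closed_Collect_disj closed_cantor_map_mem[OF contB]
        closed_cantor_map_lsc_le[OF contA]) blast+
  moreover have "A ` C = ideal_J I \<mu>"
  proof (intro set_eqI iffI)
    fix S assume "S \<in> A ` C"
    then obtain x where x: "x \<in> C" "S = A x" by blast
    have "large_indices \<mu> k S \<subseteq> B k x" for k
      using x by (auto simp: C_def large_indices_def not_le[symmetric])
    moreover have "B k x \<in> I" for k using g(2) by (auto simp: B_def)
    ultimately have "large_indices \<mu> k S \<in> I" for k using down by blast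
    moreover have "S \<subseteq> Npos" using x by (auto simp: A_def zero_set_def)
    ultimately show "S \<in> ideal_J I \<mu>" using ideal_J_iff_large_indices[OF assms(1)] by blast
  next
    fix S assume "S \<in> ideal_J I \<mu>"
    then have S: "S \<subseteq> Npos" "\<And>k. large_indices \<mu> k S \<in> range g"
      using ideal_J_iff_large_indices[OF assms(1)] g(2) by blast+
    \<comment> \<open>The sets of large indices serve as their own witnesses, so any
      \<open>g\<close>-preimages of them will do.\<close>
    define y where "y k = inv g (large_indices \<mu> k S)" for k
    have y: "large_indices \<mu> k S = g (y k)" for k
      unfolding y_def by (rule f_inv_into_f[OF S(2), symmetric])
    define w where "w k = (case k of 0 \<Rightarrow> (\<lambda>n. if n \<in> S then 0 else 1) | Suc k \<Rightarrow> y k)" for k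
    define x where "x = unslice w"
    have x: "slice k x = w k" for k unfolding x_def by (rule slice_unslice)
    have "A x = S" using zero_set_surj[OF S(1)] by (simp add: A_def x w_def)
    moreover have "B k x = large_indices \<mu> k S" for k by (simp add: B_def x w_def y)
    ultimately have "x \<in> C" by (auto simp: C_def large_indices_def not_le)
    then show "S \<in> A ` C" using \<open>A x = S\<close> by blast
  qed
  ultimately show ?thesis using analytic_in_image_closed[OF _ contA] by metis
qed

text \<open>For fixed \<open>n\<close> the condition that \<open>\<mu> n A\<close> exceeds a bound
  is open in \<open>A\<close>, but not closed in general. Naming a segment length \<open>h n\<close>
  that witnesses it turns it into a clopen condition.\<close>

lemma coanalytic_in_ideal_J:
  assumes "ideal_on_N I" "\<forall>n\<in>Npos. lsc_submeasure (\<mu> n)" "coanalytic_in cantor_topology I"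
  shows "coanalytic_in cantor_topology (ideal_J I \<mu>)"
proof -
  have down: "\<And>A B. B \<in> I \<Longrightarrow> A \<subseteq> B \<Longrightarrow> A \<in> I"
    using assms(1) unfolding ideal_on_N_def by blast
  have J: "Pow Npos - ideal_J I \<mu> = {A. A \<subseteq> Npos \<and> (\<exists>k. large_indices \<mu> k A \<notin> I)}"
    using ideal_J_iff_large_indices[OF assms(1)] by blast
  have "analytic_in cantor_topology (Pow Npos - ideal_J I \<mu>)"
  \<comment> \<open>An empty complement has no parametrisation by Baire space; in that case
    \<open>ideal_J I \<mu>\<close> is all of \<open>Pow Npos\<close> as well.\<close>
  proof (cases "Pow Npos - I = {}")
    case True
    then have "Pow Npos - ideal_J I \<mu> = {}" unfolding J by (auto simp: large_indices_def)
    then show ?thesis by (simp add: analytic_in_def)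
  next
    case False
    then obtain g :: "(nat \<Rightarrow> nat) \<Rightarrow> nat set" where g: "continuous_map euclidean cantor_topology g" "range g = Pow Npos - I"
      using assms(3)
      unfolding coanalytic_in_def analytic_in_def baire_topology_eq_euclidean
        topspace_cantor_topology topspace_euclidean
      by blast
    define A where "A = zero_set \<circ> slice 0"
    define B where "B = g \<circ> slice 1"
    define h where "h n x = slice 2 x n" for n x
    define k where "k x = slice 3 x 0" for x
    \<comment> \<open>Quantifying over the values \<open>i\<close> and \<open>j\<close> freezes the
      segment length and the threshold: each implication then has open premises and a conclusion
      about a finite part of \<open>A x\<close>, hence is closed.\<close>
    define C where "C = (\<Inter>n\<in>Npos. {x. n \<in> B x \<longrightarrow>
      (\<forall>i j. h n x = i \<and> k x = j \<longrightarrow> ennreal (1 / Suc j) < \<mu> n (A x \<inter> {1..i}))})"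
    have contA: "continuous_map euclidean cantor_topology A"
      unfolding A_def by (rule continuous_map_compose[OF continuous_map_slice continuous_map_zero_set])
    have contB: "continuous_map euclidean cantor_topology B"
      unfolding B_def by (rule continuous_map_compose[OF continuous_map_slice g(1)])
    have "open {x. h n x = i}" "open {x. k x = i}" for n i
      unfolding h_def k_def slice_def by (rule open_coordinate)+
    then have "closed C"
      unfolding C_def
      by (intro closed_INT ballI closed_Collect_all closed_Collect_imp open_Collect_conj
          closed_cantor_map_finite_part[OF contA] open_cantor_map_mem[OF contB]) blast+
    moreover have "A ` C = Pow Npos - ideal_J I \<mu>"
      unfolding J
    proof (intro set_eqI iffI)
      fix S assume "S \<in> A ` C"
      then obtain x where x: "x \<in> C" "S = A x" by blast
      have S: "S \<subseteq> Npos" using x by (auto simp: A_def zero_set_def)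
      have Bx: "B x \<subseteq> Npos" "B x \<notin> I" using g(2) by (auto simp: B_def)
      have "B x \<subseteq> large_indices \<mu> (k x) S"
      proof
        fix n assume n: "n \<in> B x"
        then have "n \<in> Npos" using Bx by blast
        moreover from this have "ennreal (1 / Suc (k x)) < \<mu> n (S \<inter> {1..h n x})"
          using x n by (simp add: C_def)
        ultimately show "n \<in> large_indices \<mu> (k x) S"
          using lsc_submeasure_gt_iff[OF _ S] assms(2) unfolding large_indices_def by blast
      qed
      then show "S \<in> {A. A \<subseteq> Npos \<and> (\<exists>k. large_indices \<mu> k A \<notin> I)}" using down Bx S by blast
    next
      fix S assume "S \<in> {A. A \<subseteq> Npos \<and> (\<exists>k. large_indices \<mu> k A \<notin> I)}"
      then obtain j where S: "S \<subseteq> Npos" "large_indices \<mu> j S \<notin> I" by blast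
      then have "large_indices \<mu> j S \<in> range g"
        unfolding g(2) by (auto simp: large_indices_def)
      then obtain y where y: "large_indices \<mu> j S = g y" by (rule imageE)
      have "\<exists>m. ennreal (1 / Suc j) < \<mu> n (S \<inter> {1..m})" if "n \<in> large_indices \<mu> j S" for n
        using that assms(2) lsc_submeasure_gt_iff[OF _ S(1)] by (auto simp: large_indices_def)
      then obtain z where z: "\<And>n. n \<in> large_indices \<mu> j S \<Longrightarrow>
          ennreal (1 / Suc j) < \<mu> n (S \<inter> {1..z n})"
        by metis
      \<comment> \<open>The list follows the slice numbers used in \<open>A\<close>,
        \<open>B\<close>, \<open>h\<close> and \<open>k\<close>; slices beyond the third are never
        read, so their values are immaterial.\<close>
      define w where "w = (!) [\<lambda>n. if n \<in> S then 0 else 1, y, z, \<lambda>_. j]"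
      define x where "x = unslice w"
      have x: "slice i x = w i" for i unfolding x_def by (rule slice_unslice)
      have "A x = S" using zero_set_surj[OF S(1)] by (simp add: A_def x w_def)
      moreover have "B x = large_indices \<mu> j S" by (simp add: B_def x w_def y)
      moreover have "h n x = z n" "k x = j" for n by (simp_all add: h_def k_def x w_def)
      ultimately have "x \<in> C" using z by (simp add: C_def)
      then show "S \<in> A ` C" using \<open>A x = S\<close> by blast
    qed
    ultimately show ?thesis using analytic_in_image_closed[OF _ contA] by metis
  qed
  then show ?thesis
    unfolding coanalytic_in_def topspace_cantor_topology by (auto simp: ideal_J_def)
qed

theorem theorem2p4:
  fixes I :: "nat set set" and \<mu> :: "nat \<Rightarrow> nat set \<Rightarrow> ennreal"
  assumes "proper_ideal_on_N I"
    and "smooth_seq \<mu>"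
    and "\<forall>n\<in>Npos. lsc_submeasure (\<mu> n)"
  shows "(borel_in cantor_topology I \<longrightarrow> borel_in cantor_topology (ideal_J I \<mu>)) \<and>
         (analytic_in cantor_topology I \<longrightarrow> analytic_in cantor_topology (ideal_J I \<mu>)) \<and>
         (coanalytic_in cantor_topology I \<longrightarrow> coanalytic_in cantor_topology (ideal_J I \<mu>))"
  using assms borel_in_ideal_J analytic_in_ideal_J coanalytic_in_ideal_J
  unfolding proper_ideal_on_N_def by blast

end
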